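(* Let $X$ be a poset and $\mathbb{Z}_2$ the field with two elements. Let $\lambda$ be an endomorphism of the abelian group $(\mathcal{P}(X),\triangle)$ with $\lambda(X)=X$, let $\psi:FI(X,\mathbb{Z}_2)\to J(FI(X,\mathbb{Z}_2))$ be a linear map with $\psi(\delta)=0$, and let $\varphi:FI(X,\mathbb{Z}_2)\to FI(X,\mathbb{Z}_2)$ be the unital linear invertibility preserver given by $\varphi(\alpha)=e_{\lambda(L_1(\alpha))}+\psi(\alpha)$. Then $\varphi$ is surjective (respectively, bijective) and strong if and only if both of the following hold: (1) $\lambda$ is an automorphism of the abelian group $(\mathcal{P}(X),\triangle)$; (2) $\psi$ maps (respectively, maps bijectively) $J(FI(X,\mathbb{Z}_2))$ onto $J(FI(X,\mathbb{Z}_2))$.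
   Context: The finitary incidence algebra $FI(X,K)$ of a poset $(X,\le)$ over a field $K$ is the $K$-space of formal sums $\alpha=\sum_{x\le y}\alpha_{xy}e_{xy}$ ($x,y\in X$, $\alpha_{xy}\in K$, $e_{xy}$ symbols) such that for all $x<y$ the set of pairs $(u,v)$ with $x\le u<v\le y$ and $\alpha_{uv}\neq 0$ is finite. The product is $\alpha\beta=\sum_{x\le y}\big(\sum_{x\le z\le y}\alpha_{xz}\beta_{zy}\big)e_{xy}$; it is a unital associative algebra with identity $\delta=\sum_{x\in X}e_{xx}$. For $A\subseteq X$, $e_A=\sum_{x\in A}e_{xx}$. Put $J(FI(X,K))=\{\alpha\in FI(X,K)\mid \alpha_{xx}=0\ \forall x\in X\}$ (this is the Jacobson radical), and $L_1(\alpha)=\{x\in X\mid \alpha_{xx}=1\}$. A map $\varphi:A\to A$ on a unital associative algebra $A$ is an invertibility preserver of $A$ if $\varphi(U(A))\subseteq U(A)$, where $U(A)$ is the group of units; it is unital if $\varphi(1_A)=1_A$. An invertibility preserver $\varphi$ of $A$ is strong if for all $a\in A$: $a\in U(A)\iff\varphi(a)\in U(A)$. $\mathcal{P}(X)$ is the set of all subsets of $X$, and $A\triangle B=(A\setminus B)\cup(B\setminus A)$ is the symmetric difference, under which $\mathcal{P}(X)$ is an abelian group. *)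

theory Defs
  imports "HOL-Library.Z2" "HOL-Algebra.Module"
begin

text \<open>
  A poset is a pair of a carrier \<open>X\<close> and a relation \<open>r\<close> with \<open>partial_order_on X r\<close>;
  \<open>(x, y) \<in> r\<close> means \<open>x \<le> y\<close>. The formal sum of the \<open>\<alpha> x y\<close> times \<open>e_xy\<close> over \<open>x \<le> y\<close> is
  encoded by its coefficient function, extended by \<open>0\<close> to the pairs outside \<open>r\<close>, so that
  equality of formal sums is equality of functions.
\<close>

definition FI_carrier :: "'a rel \<Rightarrow> ('a \<Rightarrow> 'a \<Rightarrow> 'k::field) set" where
  "FI_carrier r = {\<alpha>. (\<forall>x y. (x, y) \<notin> r \<longrightarrow> \<alpha> x y = 0) \<and>
     (\<forall>x y. (x, y) \<in> r \<and> x \<noteq> y \<longrightarrow>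
        finite {(u, v). (x, u) \<in> r \<and> (u, v) \<in> r \<and> u \<noteq> v \<and> (v, y) \<in> r \<and> \<alpha> u v \<noteq> 0})}"

text \<open>
  Intervals may be infinite, and \<open>sum\<close> over an infinite set is \<open>0\<close>; hence the convolution
  ranges over the nonzero terms only, which are finitely many by \<open>finite_FI_mult_index\<close>.
\<close>

definition FI_mult :: "'a rel \<Rightarrow> ('a \<Rightarrow> 'a \<Rightarrow> 'k::field) \<Rightarrow> ('a \<Rightarrow> 'a \<Rightarrow> 'k) \<Rightarrow> 'a \<Rightarrow> 'a \<Rightarrow> 'k" where
  "FI_mult r \<alpha> \<beta> = (\<lambda>x y.
     \<Sum>z \<in> {z. (x, z) \<in> r \<and> (z, y) \<in> r \<and> \<alpha> x z * \<beta> z y \<noteq> 0}. \<alpha> x z * \<beta> z y)"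

lemma finite_FI_mult_index:
  assumes "partial_order_on X r" and "\<alpha> \<in> FI_carrier r"
  shows "finite {z. (x, z) \<in> r \<and> (z, y) \<in> r \<and> \<alpha> x z * \<beta> z y \<noteq> 0}"
proof (cases "(x, y) \<in> r \<and> x \<noteq> y")
  case True
  let ?S = "{(u, v). (x, u) \<in> r \<and> (u, v) \<in> r \<and> u \<noteq> v \<and> (v, y) \<in> r \<and> \<alpha> u v \<noteq> 0}"
  have "(x, x) \<in> r"
    using assms(1) True by (auto simp: partial_order_on_def preorder_on_def refl_on_def)
  then have "{z. (x, z) \<in> r \<and> (z, y) \<in> r \<and> \<alpha> x z * \<beta> z y \<noteq> 0} \<subseteq> insert x (snd ` ?S)"
    by (auto simp: image_iff)
  moreover have "finite ?S"
    using assms(2) True unfolding FI_carrier_def by blast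
  ultimately show ?thesis
    by (meson finite_imageI finite_insert finite_subset)
next
  case False
  have "trans r" "antisym r"
    using assms(1) by (auto simp: partial_order_on_def preorder_on_def)
  then have "{z. (x, z) \<in> r \<and> (z, y) \<in> r \<and> \<alpha> x z * \<beta> z y \<noteq> 0} \<subseteq> {x}"
    using False by (auto dest: transD antisymD)
  then show ?thesis
    by (rule finite_subset) simp
qed

definition e_set :: "'a set \<Rightarrow> 'a \<Rightarrow> 'a \<Rightarrow> 'k::field" where
  "e_set A = (\<lambda>x y. if x = y \<and> x \<in> A then 1 else 0)"

definition FI :: "'a set \<Rightarrow> 'a rel \<Rightarrow> ('k::field, 'a \<Rightarrow> 'a \<Rightarrow> 'k) module" where
  "FI X r = \<lparr>
     carrier = FI_carrier r,
     monoid.mult = FI_mult r,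
     one = e_set X,
     zero = (\<lambda>x y. 0),
     add = (\<lambda>\<alpha> \<beta> x y. \<alpha> x y + \<beta> x y),
     smult = (\<lambda>c \<alpha> x y. c * \<alpha> x y)\<rparr>"

text \<open>The Jacobson radical, as a subspace of \<open>FI X r\<close> with the induced operations.\<close>

definition FI_J :: "'a set \<Rightarrow> 'a rel \<Rightarrow> ('k::field, 'a \<Rightarrow> 'a \<Rightarrow> 'k) module" where
  "FI_J X r = FI X r\<lparr>carrier := {\<alpha> \<in> carrier (FI X r). \<forall>x\<in>X. \<alpha> x x = 0}\<rparr>"

definition L1 :: "'a set \<Rightarrow> ('a \<Rightarrow> 'a \<Rightarrow> 'k::field) \<Rightarrow> 'a set" where
  "L1 X \<alpha> = {x \<in> X. \<alpha> x x = 1}"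

text \<open>The scalars are the whole type \<open>'k\<close>.\<close>

definition linear_map ::
    "('k, 'v, 'm) module_scheme \<Rightarrow> ('k, 'w, 'n) module_scheme \<Rightarrow> ('v \<Rightarrow> 'w) \<Rightarrow> bool" where
  "linear_map V W f \<longleftrightarrow> f \<in> carrier V \<rightarrow> carrier W \<and>
     (\<forall>a\<in>carrier V. \<forall>b\<in>carrier V. f (a \<oplus>\<^bsub>V\<^esub> b) = f a \<oplus>\<^bsub>W\<^esub> f b) \<and>
     (\<forall>c. \<forall>a\<in>carrier V. f (c \<odot>\<^bsub>V\<^esub> a) = c \<odot>\<^bsub>W\<^esub> f a)"

definition invertibility_preserver :: "('a, 'm) monoid_scheme \<Rightarrow> ('a \<Rightarrow> 'a) \<Rightarrow> bool" where
  "invertibility_preserver A f \<longleftrightarrow> f \<in> carrier A \<rightarrow> carrier A \<and> f ` Units A \<subseteq> Units A"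

definition strong_invertibility_preserver :: "('a, 'm) monoid_scheme \<Rightarrow> ('a \<Rightarrow> 'a) \<Rightarrow> bool" where
  "strong_invertibility_preserver A f \<longleftrightarrow> invertibility_preserver A f \<and>
     (\<forall>a\<in>carrier A. a \<in> Units A \<longleftrightarrow> f a \<in> Units A)"

definition Pow_group :: "'a set \<Rightarrow> 'a set monoid" where
  "Pow_group X = \<lparr>carrier = Pow X, monoid.mult = sym_diff, one = {}\<rparr>"

end

theory Submission
  imports Defs
begin

text \<open>
  Over the two-element field an element is a unit iff its diagonal is constantly \<open>1\<close>: the entry
  at \<open>(x, y)\<close> of the inverse is the parity of the number of chains from \<open>x\<close> to \<open>y\<close> all of whose
  steps lie in the support. Hence \<open>\<phi>\<close> is strong iff \<open>lam A = X\<close> forces \<open>A = X\<close>, which for an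
  additive \<open>lam\<close> with \<open>lam X = X\<close> means that \<open>lam\<close> is injective. Moreover \<open>L1 (\<phi> \<alpha>) = lam (L1 \<alpha>)\<close>
  and \<open>\<phi> = \<psi>\<close> on the radical, so \<open>\<phi>\<close> is triangular with diagonal parts \<open>lam\<close> and \<open>\<psi>\<close>.
\<close>

section \<open>Units of the finitary incidence algebra over the two-element field\<close>

definition edge :: "'a rel \<Rightarrow> ('a \<Rightarrow> 'a \<Rightarrow> 'k::field) \<Rightarrow> 'a \<Rightarrow> 'a \<Rightarrow> bool" where
  "edge r \<alpha> u v \<longleftrightarrow> (u, v) \<in> r \<and> u \<noteq> v \<and> \<alpha> u v \<noteq> 0"

text \<open>For x < y this is the set that \<open>FI_carrier\<close> requires to be finite.\<close>

definition edges_between :: "'a rel \<Rightarrow> ('a \<Rightarrow> 'a \<Rightarrow> 'k::field) \<Rightarrow> 'a \<Rightarrow> 'a \<Rightarrow> ('a \<times> 'a) set" where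
  "edges_between r \<alpha> x y = {(u, v). (x, u) \<in> r \<and> edge r \<alpha> u v \<and> (v, y) \<in> r}"

definition edge_chains :: "'a rel \<Rightarrow> ('a \<Rightarrow> 'a \<Rightarrow> 'k::field) \<Rightarrow> 'a \<Rightarrow> 'a \<Rightarrow> 'a list set" where
  "edge_chains r \<alpha> x y = {p. p \<noteq> [] \<and> hd p = x \<and> last p = y \<and> successively (edge r \<alpha>) p}"

text \<open>For \<open>\<alpha>\<close> with diagonal 1 over the two-element field this is the
  geometric series for the inverse of 1 + n, with n the off-diagonal part: chains of k steps give
  the entries of the k-th power of n, and signs disappear. The guard excludes points x outside the
  carrier, where \<open>[x]\<close> is still a chain from x to x.\<close>

definition chain_parity :: "'a rel \<Rightarrow> ('a \<Rightarrow> 'a \<Rightarrow> 'k::field) \<Rightarrow> 'a \<Rightarrow> 'a \<Rightarrow> bit" where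
  "chain_parity r \<alpha> x y = (if (x, y) \<in> r then of_nat (card (edge_chains r \<alpha> x y)) else 0)"

lemma partial_order_onD:
  assumes "partial_order_on X r"
  shows "(x, y) \<in> r \<Longrightarrow> x \<in> X" "(x, y) \<in> r \<Longrightarrow> y \<in> X" "x \<in> X \<Longrightarrow> (x, x) \<in> r"
    "(x, y) \<in> r \<Longrightarrow> (y, z) \<in> r \<Longrightarrow> (x, z) \<in> r" "(x, y) \<in> r \<Longrightarrow> (y, x) \<in> r \<Longrightarrow> x = y"
  using assms
  by (auto simp: partial_order_on_def preorder_on_def refl_on_def dest: transD antisymD)

lemma edges_between_mono:
  assumes "partial_order_on X r" "(x, x') \<in> r" "(y', y) \<in> r"
  shows "edges_between r \<alpha> x' y' \<subseteq> edges_between r \<alpha> x y"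
  using assms(2,3) partial_order_onD(4)[OF assms(1)] unfolding edges_between_def by blast

lemma FI_carrier_iff:
  "\<alpha> \<in> FI_carrier r \<longleftrightarrow> (\<forall>x y. (x, y) \<notin> r \<longrightarrow> \<alpha> x y = 0) \<and>
     (\<forall>x y. (x, y) \<in> r \<and> x \<noteq> y \<longrightarrow> finite (edges_between r \<alpha> x y))"
proof -
  have "edges_between r \<alpha> x y =
      {(u, v). (x, u) \<in> r \<and> (u, v) \<in> r \<and> u \<noteq> v \<and> (v, y) \<in> r \<and> \<alpha> u v \<noteq> 0}" for x y
    by (auto simp: edges_between_def edge_def)
  then show ?thesis
    by (simp add: FI_carrier_def)
qed

text \<open>An edge between x and y already forces x < y by antisymmetry, so for every other pair
  the set is empty.\<close>

lemma finite_edges_between: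
  assumes "partial_order_on X r" "\<alpha> \<in> FI_carrier r"
  shows "finite (edges_between r \<alpha> x y)"
proof (cases "(x, y) \<in> r \<and> x \<noteq> y")
  case True
  then show ?thesis
    using assms(2) by (auto simp: FI_carrier_iff)
next
  case False
  note po = partial_order_onD[OF assms(1)]
  have "edges_between r \<alpha> x y = {}"
  proof (rule equals0I, clarify)
    fix u v assume "(u, v) \<in> edges_between r \<alpha> x y"
    then have uv: "(x, u) \<in> r" "(u, v) \<in> r" "(v, y) \<in> r" "u \<noteq> v"
      by (auto simp: edges_between_def edge_def)
    then have "x = y"
      using False po(4)[OF po(4)[OF uv(1,2)] uv(3)] by simp
    then show False
      using uv po(5)[OF uv(2) po(4)[OF uv(3)]] by blast
  qed
  then show ?thesis
    by simp
qed

section \<open>Chains of support edges: recursion, finiteness, counting\<close>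

lemma chains_unfold:
  "edge_chains r \<alpha> x y = (if x = y then {[x]} else {}) \<union> (\<Union>z\<in>{z. edge r \<alpha> x z}. Cons x ` edge_chains r \<alpha> z y)"
  (is "?L = ?R")
proof (intro equalityI subsetI)
  fix p assume p: "p \<in> ?L"
  then obtain q where q: "p = x # q"
    by (cases p) (auto simp: edge_chains_def)
  show "p \<in> ?R"
  proof (cases "q = []")
    case False
    then have "edge r \<alpha> x (hd q)" "q \<in> edge_chains r \<alpha> (hd q) y"
      using p unfolding q edge_chains_def by (simp_all add: successively_Cons)
    then show ?thesis
      unfolding q by blast
  qed (use p q in \<open>simp add: edge_chains_def\<close>)
next
  fix p assume "p \<in> ?R"
  then consider "x = y" "p = [x]"
    | z q where "p = x # q" "edge r \<alpha> x z" "q \<in> edge_chains r \<alpha> z y"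
    by (auto split: if_splits)
  then show "p \<in> ?L"
    by cases (simp_all add: edge_chains_def successively_Cons)
qed

text \<open>Every vertex after the first is the target of a step of the chain, and by transitivity
  that step lies between x and y. The assumption \<open>y \<in> X\<close> covers the trivial
  chain.\<close>

lemma chains_le:
  assumes "partial_order_on X r" "p \<in> edge_chains r \<alpha> x y" "y \<in> X"
  shows "(x, y) \<in> r \<and> set p \<subseteq> insert x (snd ` edges_between r \<alpha> x y)"
  using assms(2)
proof (induction p arbitrary: x)
  case Nil
  then show ?case by (simp add: edge_chains_def)
next
  case (Cons a p)
  note po = partial_order_onD[OF assms(1)]
  from Cons.prems consider "a = x" "x = y" "p = []" 
    | z where "a = x" "edge r \<alpha> x z" "p \<in> edge_chains r \<alpha> z y"
    by (subst (asm) chains_unfold) (auto split: if_splits)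
  then show ?case
  proof cases
    case 1
    then show ?thesis using po(3) assms(3) by simp
  next
    case 2
    have IH: "(z, y) \<in> r" "set p \<subseteq> insert z (snd ` edges_between r \<alpha> z y)"
      using Cons.IH[OF 2(3)] by auto
    have xz: "(x, z) \<in> r" "(x, x) \<in> r"
      using 2(2) po(1,3) by (auto simp: edge_def)
    have "edges_between r \<alpha> z y \<subseteq> edges_between r \<alpha> x y"
      using xz po(3) assms(3) by (intro edges_between_mono[OF assms(1)])
    moreover have "(x, z) \<in> edges_between r \<alpha> x y"
      using xz IH(1) 2(2) by (auto simp: edges_between_def)
    then have "z \<in> snd ` edges_between r \<alpha> x y"
      by force
    ultimately show ?thesis
      using IH(2) po(4)[OF xz(1) IH(1)] 2(1) by auto
  qed
qed

text \<open>The strict order is transitive, so strictness of consecutive steps spreads to all pairs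
  of positions.\<close>

lemma distinct_chain:
  assumes "partial_order_on X r" "p \<in> edge_chains r \<alpha> x y"
  shows "distinct p"
proof -
  let ?R = "\<lambda>u v. (u, v) \<in> r \<and> u \<noteq> v"
  have "transp ?R"
    using partial_order_onD(4,5)[OF assms(1)] by (intro transpI) blast
  moreover have "successively ?R p"
    using assms(2) by (auto simp: edge_chains_def edge_def intro: successively_mono)
  ultimately have "sorted_wrt ?R p"
    by (simp add: successively_conv_sorted_wrt)
  then show ?thesis
    by (induction p) auto
qed

lemma finite_chains:
  assumes "partial_order_on X r" "\<alpha> \<in> FI_carrier r" "y \<in> X"
  shows "finite (edge_chains r \<alpha> x y)"
proof (rule finite_subset)
  let ?V = "insert x (snd ` edges_between r \<alpha> x y)"
  show "edge_chains r \<alpha> x y \<subseteq> {p. set p \<subseteq> ?V \<and> distinct p}"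
    using distinct_chain[OF assms(1)] chains_le[OF assms(1) _ assms(3)] by blast
  show "finite {p. set p \<subseteq> ?V \<and> distinct p}"
    by (intro finite_subset_distinct finite.insertI finite_imageI finite_edges_between[OF assms(1,2)])
qed

lemma chains_refl:
  assumes "partial_order_on X r" "x \<in> X"
  shows "edge_chains r \<alpha> x x = {[x]}"
proof -
  have "edge_chains r \<alpha> z x = {}" if "edge r \<alpha> x z" for z
    using chains_le[OF assms(1) _ assms(2)] partial_order_onD(5)[OF assms(1)] that
    unfolding edge_def by blast
  then show ?thesis
    by (subst chains_unfold) auto
qed

text \<open>Chains are sorted by their second vertex. Restricting to \<open>(z, y) \<in> r\<close>
  discards only vertices without a chain to y and makes the index set finite.\<close>

lemma card_chains:
  assumes "partial_order_on X r" "\<alpha> \<in> FI_carrier r" "y \<in> X" "x \<noteq> y"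
  shows "card (edge_chains r \<alpha> x y) = (\<Sum>z | edge r \<alpha> x z \<and> (z, y) \<in> r. card (edge_chains r \<alpha> z y))"
proof -
  let ?Z = "{z. edge r \<alpha> x z \<and> (z, y) \<in> r}"
  have "(x, x) \<in> r" if "edge r \<alpha> x z" for z
    using that partial_order_onD(1,3)[OF assms(1)] by (auto simp: edge_def)
  then have "?Z \<subseteq> snd ` edges_between r \<alpha> x y"
    by (force simp: edges_between_def)
  then have fin: "finite ?Z"
    using finite_edges_between[OF assms(1,2)] finite_subset by blast
  have "edge_chains r \<alpha> x y = (\<Union>z\<in>{z. edge r \<alpha> x z}. Cons x ` edge_chains r \<alpha> z y)"
    using assms(4) by (subst chains_unfold) auto
  also have "\<dots> = (\<Union>z\<in>?Z. Cons x ` edge_chains r \<alpha> z y)"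
    using chains_le[OF assms(1) _ assms(3)] by blast
  finally have "card (edge_chains r \<alpha> x y) = card (\<Union>z\<in>?Z. Cons x ` edge_chains r \<alpha> z y)"
    by (rule arg_cong)
  also have "\<dots> = (\<Sum>z\<in>?Z. card (Cons x ` edge_chains r \<alpha> z y))"
  proof (rule card_UN_disjoint[OF fin])
    show "\<forall>z\<in>?Z. finite (Cons x ` edge_chains r \<alpha> z y)"
      by (simp add: finite_chains[OF assms(1-3)])
    show "\<forall>z\<in>?Z. \<forall>w\<in>?Z. z \<noteq> w \<longrightarrow>
        Cons x ` edge_chains r \<alpha> z y \<inter> Cons x ` edge_chains r \<alpha> w y = {}"
    proof (intro ballI impI equals0I)
      fix z w p assume "z \<noteq> w"
        and "p \<in> Cons x ` edge_chains r \<alpha> z y \<inter> Cons x ` edge_chains r \<alpha> w y"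
      then have "hd (tl p) = z" "hd (tl p) = w"
        by (force simp: edge_chains_def)+
      with \<open>z \<noteq> w\<close> show False
        by simp
    qed
  qed
  finally show ?thesis
    by (simp add: card_image[OF inj_on_Cons1])
qed

text \<open>A nonzero entry at (u, v) comes from a chain, whose first edge starts at u and whose
  last edge ends at v. Both ends are thus confined to projections of a finite edge set.\<close>

lemma chain_parity_in_FI:
  assumes "partial_order_on X r" "\<alpha> \<in> FI_carrier r"
  shows "chain_parity r \<alpha> \<in> FI_carrier r"
proof -
  note po = partial_order_onD[OF assms(1)]
  have "edges_between r (chain_parity r \<alpha>) x y \<subseteq>
      fst ` edges_between r \<alpha> x y \<times> snd ` edges_between r \<alpha> x y" for x y
  proof (rule subrelI)
    fix u v assume "(u, v) \<in> edges_between r (chain_parity r \<alpha>) x y"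
    then have uv: "(x, u) \<in> r" "(u, v) \<in> r" "(v, y) \<in> r" "u \<noteq> v"
      and "edge_chains r \<alpha> u v \<noteq> {}"
      by (auto simp: edges_between_def edge_def chain_parity_def)
    then obtain p where p: "p \<in> edge_chains r \<alpha> u v"
      by blast
    note le = chains_le[OF assms(1) _ po(2)[OF uv(2)]]
    obtain z q where z: "edge r \<alpha> u z" "q \<in> edge_chains r \<alpha> z v"
      using p uv(4) by (subst (asm) chains_unfold) auto
    \<comment> \<open>As v differs from u, \<open>chains_le\<close> exhibits it as the target of an
      edge.\<close>
    have "v \<in> set p"
      using p by (auto simp: edge_chains_def)
    then obtain w where "(w, v) \<in> edges_between r \<alpha> u v"
      using le[OF p] uv(4) by force
    then have "(w, v) \<in> edges_between r \<alpha> x y"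
      using edges_between_mono[OF assms(1) uv(1,3)] by (rule subsetD[rotated])
    moreover have "(u, z) \<in> edges_between r \<alpha> x y"
      using uv(1) z(1) po(4)[OF conjunct1[OF le[OF z(2)]] uv(3)] by (simp add: edges_between_def)
    ultimately show "(u, v) \<in> fst ` edges_between r \<alpha> x y \<times> snd ` edges_between r \<alpha> x y"
      by (simp add: image_iff) force
  qed
  then have "finite (edges_between r (chain_parity r \<alpha>) x y)" for x y
    by (rule finite_subset) (simp add: finite_edges_between[OF assms])
  then show ?thesis
    by (simp add: FI_carrier_iff chain_parity_def)
qed

section \<open>Convolution with the chain parity\<close>

lemma FI_mult_refl:
  assumes "partial_order_on X r" "x \<in> X"
  shows "FI_mult r \<alpha> \<beta> x x = \<alpha> x x * \<beta> x x"
proof -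
  have "{z. (x, z) \<in> r \<and> (z, x) \<in> r \<and> \<alpha> x z * \<beta> z x \<noteq> 0} =
      (if \<alpha> x x * \<beta> x x \<noteq> 0 then {x} else {})"
    using partial_order_onD(3)[OF assms] by (auto dest: partial_order_onD(5)[OF assms(1)])
  then show ?thesis
    by (simp add: FI_mult_def)
qed

lemma FI_mult_outside:
  assumes "partial_order_on X r" "(x, y) \<notin> r"
  shows "FI_mult r \<alpha> \<beta> x y = 0"
proof -
  have "{z. (x, z) \<in> r \<and> (z, y) \<in> r \<and> \<alpha> x z * \<beta> z y \<noteq> 0} = {}"
    using assms(2) by (auto dest: partial_order_onD(4)[OF assms(1)])
  then show ?thesis
    unfolding FI_mult_def by (simp only: sum.empty)
qed

text \<open>Bit sums and products stay in field notation, so that ring lemmas apply to them.\<close>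

declare add_bit_eq_xor [simp del] mult_bit_eq_and [simp del]

lemma bit_add_self [simp]: "(a :: bit) + a = 0"
  by (cases a) auto

text \<open>Off the diagonal, the term z = x equals the chain parity at (x, y), and by
  \<open>card_chains\<close> the remaining terms sum to the same value; the two cancel in
  characteristic 2.\<close>

lemma FI_mult_chain_parity:
  fixes \<alpha> :: "'a \<Rightarrow> 'a \<Rightarrow> bit"
  assumes "partial_order_on X r" "\<alpha> \<in> FI_carrier r" "L1 X \<alpha> = X"
  shows "FI_mult r \<alpha> (chain_parity r \<alpha>) = e_set X"
proof (intro ext)
  fix x y
  note po = partial_order_onD[OF assms(1)]
  let ?\<beta> = "chain_parity r \<alpha>"
  have diag: "\<alpha> x x = 1" if "x \<in> X" for x
    using that assms(3) by (auto simp: L1_def)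
  consider "(x, y) \<notin> r" | "x = y" "x \<in> X" | "(x, y) \<in> r" "x \<noteq> y"
    using po(1) by blast
  then show "FI_mult r \<alpha> ?\<beta> x y = e_set X x y"
  proof cases
    case 1
    then show ?thesis
      using FI_mult_outside[OF assms(1)] po(3) by (auto simp: e_set_def)
  next
    case 2
    then show ?thesis
      using diag[OF 2(2)] po(3)[OF 2(2)]
      by (simp add: FI_mult_refl[OF assms(1)] chains_refl[OF assms(1)] e_set_def chain_parity_def)
  next
    case 3
    let ?S = "{z. (x, z) \<in> r \<and> (z, y) \<in> r \<and> \<alpha> x z * ?\<beta> z y \<noteq> 0}"
    let ?Z = "{z. edge r \<alpha> x z \<and> (z, y) \<in> r}"
    have x: "x \<in> X" "y \<in> X" "(x, x) \<in> r" "\<alpha> x x = 1"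
      using 3 po(1,2,3) diag by blast+
    have "?Z \<subseteq> snd ` edges_between r \<alpha> x y"
      using x by (force simp: edges_between_def)
    then have fin: "finite ?Z"
      using finite_edges_between[OF assms(1,2)] finite_subset by blast
    have "FI_mult r \<alpha> ?\<beta> x y = (\<Sum>z\<in>?S. \<alpha> x z * ?\<beta> z y)"
      by (simp add: FI_mult_def)
    \<comment> \<open>The indices added to \<open>?S\<close> carry only zero terms.\<close>
    also have "\<dots> = (\<Sum>z\<in>insert x ?Z. \<alpha> x z * ?\<beta> z y)"
    proof (rule sum.mono_neutral_left)
      show "finite (insert x ?Z)" using fin by simp
      show "?S \<subseteq> insert x ?Z" by (auto simp: edge_def)
      show "\<forall>z\<in>insert x ?Z - ?S. \<alpha> x z * ?\<beta> z y = 0"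
        using x(3) 3(1) by (auto simp: edge_def)
    qed
    also have "\<dots> = ?\<beta> x y + (\<Sum>z\<in>?Z. \<alpha> x z * ?\<beta> z y)"
      using fin x(4) by (simp add: edge_def)
    \<comment> \<open>Along an edge the coefficient of \<open>\<alpha>\<close> is nonzero, hence
      1.\<close>
    also have "(\<Sum>z\<in>?Z. \<alpha> x z * ?\<beta> z y) = (\<Sum>z\<in>?Z. of_nat (card (edge_chains r \<alpha> z y)))"
      by (intro sum.cong) (auto simp: edge_def chain_parity_def)
    also have "\<dots> = ?\<beta> x y"
      using 3 card_chains[OF assms(1,2) x(2) 3(2)] by (simp add: chain_parity_def)
    finally show ?thesis
      using 3 by (simp add: e_set_def)
  qed
qed

text \<open>Reversing the order exchanges the two factors, so the same chain count is a left inverse.\<close>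

lemma chain_parity_converse: "chain_parity (r\<inverse>) (\<lambda>x y. \<alpha> y x) x y = chain_parity r \<alpha> y x"
proof -
  have edge: "edge (r\<inverse>) (\<lambda>x y. \<alpha> y x) = (\<lambda>u v. edge r \<alpha> v u)"
    by (auto simp: edge_def fun_eq_iff)
  have "bij_betw rev (edge_chains (r\<inverse>) (\<lambda>x y. \<alpha> y x) x y) (edge_chains r \<alpha> y x)"
    by (rule bij_betw_byWitness[where f' = rev])
      (auto simp: edge_chains_def edge hd_rev last_rev)
  then have "card (edge_chains (r\<inverse>) (\<lambda>x y. \<alpha> y x) x y) = card (edge_chains r \<alpha> y x)"
    by (rule bij_betw_same_card)
  then show ?thesis
    by (simp add: chain_parity_def)
qed

lemma FI_carrier_converse:
  assumes "\<alpha> \<in> FI_carrier r"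
  shows "(\<lambda>x y. \<alpha> y x) \<in> FI_carrier (r\<inverse>)"
proof -
  have "edges_between (r\<inverse>) (\<lambda>x y. \<alpha> y x) x y = prod.swap ` edges_between r \<alpha> y x" for x y
    by (auto simp: edges_between_def edge_def image_iff)
  then show ?thesis
    using assms by (auto simp: FI_carrier_iff)
qed

lemma FI_mult_converse:
  "FI_mult (r\<inverse>) (\<lambda>x y. \<alpha> y x) (\<lambda>x y. \<beta> y x) x y = FI_mult r \<beta> \<alpha> y x"
  unfolding FI_mult_def by (intro sum.cong) (auto simp: mult.commute)

lemma chain_parity_FI_mult:
  fixes \<alpha> :: "'a \<Rightarrow> 'a \<Rightarrow> bit"
  assumes "partial_order_on X r" "\<alpha> \<in> FI_carrier r" "L1 X \<alpha> = X"
  shows "FI_mult r (chain_parity r \<alpha>) \<alpha> = e_set X"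
proof (intro ext)
  fix x y
  let ?\<alpha> = "\<lambda>x y. \<alpha> y x"
  have "FI_mult (r\<inverse>) ?\<alpha> (chain_parity (r\<inverse>) ?\<alpha>) = e_set X"
    using assms FI_carrier_converse by (intro FI_mult_chain_parity) (auto simp: L1_def)
  moreover have "chain_parity (r\<inverse>) ?\<alpha> = (\<lambda>x y. chain_parity r \<alpha> y x)"
    by (simp add: fun_eq_iff chain_parity_converse)
  ultimately have "FI_mult r (chain_parity r \<alpha>) \<alpha> x y = e_set X y x"
    by (simp flip: FI_mult_converse)
  then show "FI_mult r (chain_parity r \<alpha>) \<alpha> x y = e_set X x y"
    by (auto simp: e_set_def)
qed

text \<open>Diagonals multiply pointwise, so a right inverse makes every diagonal entry nonzero,
  that is, 1. Conversely \<open>chain_parity\<close> is a two-sided inverse.\<close>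

theorem Units_FI_iff:
  fixes \<alpha> :: "'a \<Rightarrow> 'a \<Rightarrow> bit"
  assumes "partial_order_on X r" "\<alpha> \<in> FI_carrier r"
  shows "\<alpha> \<in> Units (FI X r) \<longleftrightarrow> L1 X \<alpha> = X"
proof
  assume "\<alpha> \<in> Units (FI X r)"
  then obtain \<beta> where "FI_mult r \<alpha> \<beta> = e_set X"
    by (auto simp: Units_def FI_def)
  then have "\<alpha> x x * \<beta> x x = 1" if "x \<in> X" for x
    using FI_mult_refl[OF assms(1) that, of \<alpha> \<beta>] that by (simp add: e_set_def)
  then show "L1 X \<alpha> = X"
    by (force simp: L1_def simp flip: bit_not_zero_iff)
next
  assume "L1 X \<alpha> = X"
  then show "\<alpha> \<in> Units (FI X r)"
    using FI_mult_chain_parity[OF assms] chain_parity_FI_mult[OF assms]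
      chain_parity_in_FI[OF assms] assms(2)
    by (auto simp: Units_def FI_def)
qed

section \<open>Preservers of diagonal form\<close>

lemma FI_add_closed:
  assumes "\<alpha> \<in> FI_carrier r" "\<beta> \<in> FI_carrier r"
  shows "(\<lambda>x y. \<alpha> x y + \<beta> x y) \<in> FI_carrier r"
proof -
  have "edges_between r (\<lambda>x y. \<alpha> x y + \<beta> x y) x y \<subseteq> edges_between r \<alpha> x y \<union> edges_between r \<beta> x y"
    for x y by (auto simp: edges_between_def edge_def)
  then have "finite (edges_between r (\<lambda>x y. \<alpha> x y + \<beta> x y) x y)"
    if "finite (edges_between r \<alpha> x y)" "finite (edges_between r \<beta> x y)" for x y
    using that by (meson finite_UnI finite_subset)
  then show ?thesis
    using assms by (simp add: FI_carrier_iff)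
qed

lemma e_set_in_FI:
  fixes X :: "'a set"
  assumes "partial_order_on X r" "A \<subseteq> X"
  shows "(e_set A :: 'a \<Rightarrow> 'a \<Rightarrow> 'k::field) \<in> FI_carrier r"
proof -
  have "edges_between r (e_set A :: 'a \<Rightarrow> 'a \<Rightarrow> 'k) x y = {}" for x y
    by (auto simp: edges_between_def edge_def e_set_def)
  moreover have "e_set A x y = (0 :: 'k)" if "(x, y) \<notin> r" for x y
    using that assms(2) partial_order_onD(3)[OF assms(1)] by (auto simp: e_set_def)
  ultimately show ?thesis
    by (simp add: FI_carrier_iff)
qed

lemma L1_e_set: "A \<subseteq> X \<Longrightarrow> L1 X (e_set A) = A"
  by (auto simp: L1_def e_set_def)

text \<open>Over the two-element field \<open>L1\<close> determines the diagonal, and adding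
  indicator functions modulo 2 is symmetric difference. So \<open>L1\<close> is additive into
  \<open>Pow_group X\<close>.\<close>

lemma L1_add:
  fixes \<alpha> \<beta> :: "'a \<Rightarrow> 'a \<Rightarrow> bit"
  shows "L1 X (\<lambda>x y. \<alpha> x y + \<beta> x y) = sym_diff (L1 X \<alpha>) (L1 X \<beta>)"
proof -
  have "a + b = 1 \<longleftrightarrow> (a = 1) \<noteq> (b = 1)" for a b :: bit
    by (cases a; cases b) auto
  then show ?thesis
    by (auto simp: L1_def)
qed

lemma FI_J_carrier:
  fixes r :: "'a rel"
  shows "carrier (FI_J X r :: (bit, _) module) = {\<alpha> \<in> FI_carrier r. L1 X \<alpha> = {}}"
  by (auto simp: FI_J_def FI_def L1_def)


theorem corollary2p32:
  fixes X :: "'a set" and r :: "'a rel"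
    and lam :: "'a set \<Rightarrow> 'a set"
    and \<psi> \<phi> :: "('a \<Rightarrow> 'a \<Rightarrow> bit) \<Rightarrow> ('a \<Rightarrow> 'a \<Rightarrow> bit)"
  assumes poset: "partial_order_on X r"
    and lam_endo: "lam \<in> hom (Pow_group X) (Pow_group X)"
    and lam_X: "lam X = X"
    and \<psi>_linear: "linear_map (FI X r) (FI_J X r) \<psi>"
    and \<psi>_unit: "\<psi> \<one>\<^bsub>FI X r\<^esub> = \<zero>\<^bsub>FI X r\<^esub>"
    and \<phi>_eq: "\<And>\<alpha>. \<alpha> \<in> carrier (FI X r) \<Longrightarrow>
           \<phi> \<alpha> = e_set (lam (L1 X \<alpha>)) \<oplus>\<^bsub>FI X r\<^esub> \<psi> \<alpha>"
    and \<phi>_linear: "linear_map (FI X r) (FI X r) \<phi>"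
    and \<phi>_unital: "\<phi> \<one>\<^bsub>FI X r\<^esub> = \<one>\<^bsub>FI X r\<^esub>"
    and \<phi>_preserver: "invertibility_preserver (FI X r) \<phi>"
  shows
    "(\<phi> ` carrier (FI X r) = carrier (FI X r) \<and> strong_invertibility_preserver (FI X r) \<phi>
      \<longleftrightarrow> lam \<in> iso (Pow_group X) (Pow_group X) \<and>
          \<psi> ` carrier (FI_J X r) = carrier (FI_J X r))
   \<and> (bij_betw \<phi> (carrier (FI X r)) (carrier (FI X r)) \<and> strong_invertibility_preserver (FI X r) \<phi>
      \<longleftrightarrow> lam \<in> iso (Pow_group X) (Pow_group X) \<and>
          bij_betw \<psi> (carrier (FI_J X r)) (carrier (FI_J X r)))"
proof -
  let ?C = "FI_carrier r :: ('a \<Rightarrow> 'a \<Rightarrow> bit) set"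
  let ?J = "{\<alpha> \<in> ?C. L1 X \<alpha> = {}}"
  have \<psi>_J: "\<psi> \<alpha> \<in> ?J" if "\<alpha> \<in> ?C" for \<alpha>
    using \<psi>_linear that unfolding linear_map_def FI_J_carrier by (auto simp: FI_def)
  have \<psi>_add: "\<psi> (\<lambda>x y. \<alpha> x y + \<beta> x y) = (\<lambda>x y. \<psi> \<alpha> x y + \<psi> \<beta> x y)"
    if "\<alpha> \<in> ?C" "\<beta> \<in> ?C" for \<alpha> \<beta>
    using \<psi>_linear that by (simp add: linear_map_def FI_def FI_J_def)
  have \<phi>: "\<phi> \<alpha> = (\<lambda>x y. e_set (lam (L1 X \<alpha>)) x y + \<psi> \<alpha> x y)" if "\<alpha> \<in> ?C" for \<alpha>
    using \<phi>_eq that by (simp add: FI_def)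
  have lam_sub: "lam A \<subseteq> X" if "A \<subseteq> X" for A
    using lam_endo that by (auto simp: hom_def Pow_group_def)
  have lam_add: "lam (sym_diff A B) = sym_diff (lam A) (lam B)" if "A \<subseteq> X" "B \<subseteq> X" for A B
    using lam_endo that by (auto simp: hom_def Pow_group_def)
  have lam_empty: "lam {} = {}"
    using lam_add[of "{}" "{}"] by simp
  have L1_sub: "L1 X \<alpha> \<subseteq> X" for \<alpha> :: "'a \<Rightarrow> 'a \<Rightarrow> bit"
    by (auto simp: L1_def)
  note lam_L1_sub = lam_sub[OF L1_sub]
  have \<phi>_C: "\<phi> \<alpha> \<in> ?C" if "\<alpha> \<in> ?C" for \<alpha>
    using \<phi>_linear that by (auto simp: linear_map_def FI_def)
  \<comment> \<open>\<open>\<psi>\<close> takes values with zero diagonal, so only the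
    \<open>e_set\<close> summand contributes.\<close>
  have L1_\<phi>: "L1 X (\<phi> \<alpha>) = lam (L1 X \<alpha>)" if "\<alpha> \<in> ?C" for \<alpha>
    using \<phi>[OF that] \<psi>_J[OF that] by (simp add: L1_add L1_e_set[OF lam_L1_sub])
  have \<phi>_radical: "\<phi> \<alpha> = \<psi> \<alpha>" if "\<alpha> \<in> ?J" for \<alpha>
    using \<phi> that by (simp add: lam_empty e_set_def)
  have e_C: "e_set A \<in> ?C" if "A \<subseteq> X" for A
    by (rule e_set_in_FI[OF poset that])

  \<comment> \<open>Strongness as injectivity of \<open>lam\<close>\<close>
  have strong_iff: "strong_invertibility_preserver (FI X r) \<phi> \<longleftrightarrow> inj_on lam (Pow X)"
  proof -
    have "strong_invertibility_preserver (FI X r) \<phi> \<longleftrightarrow>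
        (\<forall>\<alpha>\<in>?C. L1 X \<alpha> = X \<longleftrightarrow> lam (L1 X \<alpha>) = X)"
      using \<phi>_preserver Units_FI_iff[OF poset] \<phi>_C L1_\<phi>
      by (simp add: strong_invertibility_preserver_def FI_def)
    also have "\<dots> \<longleftrightarrow> (\<forall>A\<subseteq>X. lam A = X \<longrightarrow> A = X)"
    proof
      assume "\<forall>\<alpha>\<in>?C. L1 X \<alpha> = X \<longleftrightarrow> lam (L1 X \<alpha>) = X"
      then show "\<forall>A\<subseteq>X. lam A = X \<longrightarrow> A = X"
        \<comment> \<open>Testing on \<open>e_set A\<close> lets \<open>L1\<close> run through all
          subsets.\<close>
        using e_C L1_e_set by metis
    qed (use L1_sub lam_X in auto)
    also have "\<dots> \<longleftrightarrow> inj_on lam (Pow X)"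
    proof
      assume X: "\<forall>A\<subseteq>X. lam A = X \<longrightarrow> A = X"
      show "inj_on lam (Pow X)"
      proof (rule inj_onI)
        fix A B assume AB: "A \<in> Pow X" "B \<in> Pow X" "lam A = lam B"
        \<comment> \<open>\<open>?D\<close> is the complement in X of the difference of A and B.
          Since \<open>lam\<close> kills that difference and fixes X, it sends \<open>?D\<close> to
          X.\<close>
        let ?D = "sym_diff X (sym_diff A B)"
        have "lam ?D = sym_diff (lam X) (lam (sym_diff A B))"
          using AB(1,2) by (intro lam_add) auto
        also have "lam (sym_diff A B) = {}"
          using AB by (subst lam_add) auto
        finally have "lam ?D = X"
          using lam_X by simp
        moreover have "?D \<subseteq> X"
          using AB(1,2) by blast
        ultimately have "?D = X"
          using X by blast
        then show "A = B"
          using AB(1,2) by blast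
      qed
    next
      assume "inj_on lam (Pow X)"
      then show "\<forall>A\<subseteq>X. lam A = X \<longrightarrow> A = X"
        using lam_X by (metis PowI inj_onD order_refl)
    qed
    finally show ?thesis .
  qed
  have iso_iff: "lam \<in> iso (Pow_group X) (Pow_group X) \<longleftrightarrow>
      inj_on lam (Pow X) \<and> lam ` Pow X = Pow X"
    using lam_endo by (auto simp: iso_def bij_betw_def Pow_group_def)

  \<comment> \<open>Surjectivity, given injectivity of \<open>lam\<close>\<close>
  have surj_iff: "\<phi> ` ?C = ?C \<longleftrightarrow> lam ` Pow X = Pow X \<and> \<psi> ` ?J = ?J" if inj: "inj_on lam (Pow X)"
  proof
    assume surj: "\<phi> ` ?C = ?C"
    have "\<exists>B\<subseteq>X. lam B = A" if A: "A \<subseteq> X" for A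
    proof -
      obtain \<alpha> where "\<alpha> \<in> ?C" "e_set A = \<phi> \<alpha>"
        using surj e_C[OF A] by blast
      then have "A = lam (L1 X \<alpha>)"
        using L1_\<phi> L1_e_set[OF A] by metis
      then show ?thesis
        using L1_sub by metis
    qed
    then have "lam ` Pow X = Pow X"
      using lam_sub by (intro equalityI subsetI) auto
    moreover have "\<beta> \<in> \<psi> ` ?J" if \<beta>: "\<beta> \<in> ?J" for \<beta>
    proof -
      obtain \<alpha> where \<alpha>: "\<alpha> \<in> ?C" "\<beta> = \<phi> \<alpha>"
        using surj \<beta> by blast
      \<comment> \<open>Injectivity of \<open>lam\<close> places the preimage of a radical element
        in the radical, where \<open>\<phi>\<close> and \<open>\<psi>\<close> agree.\<close>
      then have "lam (L1 X \<alpha>) = lam {}"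
        using L1_\<phi> \<beta> lam_empty by auto
      then have "L1 X \<alpha> = {}"
        by (rule inj_onD[OF inj]) (simp_all add: L1_sub)
      then show ?thesis
        using \<alpha> \<phi>_radical by blast
    qed
    then have "?J \<subseteq> \<psi> ` ?J"
      by (rule subsetI)
    moreover have "\<psi> ` ?J \<subseteq> ?J"
      using \<psi>_J by (intro image_subsetI) simp
    ultimately show "lam ` Pow X = Pow X \<and> \<psi> ` ?J = ?J"
      by (simp only: subset_antisym simp_thms)
  next
    assume surj: "lam ` Pow X = Pow X \<and> \<psi> ` ?J = ?J"
    have "\<beta> \<in> \<phi> ` ?C" if \<beta>: "\<beta> \<in> ?C" for \<beta>
    proof -
      obtain B where B: "B \<subseteq> X" "L1 X \<beta> = lam B"
      proof -
        have "L1 X \<beta> \<in> lam ` Pow X"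
          using surj L1_sub by simp
        then show thesis
          by (elim imageE) (simp add: that)
      qed
      \<comment> \<open>The error of approximating \<open>\<beta>\<close> by
        \<open>\<phi> (e_set B)\<close>; sum and difference coincide. The choice of B makes its
        diagonal vanish, so \<open>\<psi>\<close> hits it at a radical element
        \<open>\<gamma>\<close>, which then corrects \<open>e_set B\<close> without changing
        \<open>L1\<close>.\<close>
      let ?\<delta> = "\<lambda>x y. \<beta> x y + \<phi> (e_set B) x y"
      have "?\<delta> \<in> ?J"
        using \<beta> B \<phi>_C e_C FI_add_closed[of \<beta> r "\<phi> (e_set B)"]
        by (simp add: L1_add L1_\<phi> L1_e_set)
      then have "?\<delta> \<in> \<psi> ` ?J"
        using surj by simp
      then obtain \<gamma> where \<gamma>: "\<gamma> \<in> ?J" "\<psi> \<gamma> = ?\<delta>"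
        by (elim imageE) simp
      let ?\<alpha> = "\<lambda>x y. e_set B x y + \<gamma> x y"
      have L1: "L1 X ?\<alpha> = B"
        using \<gamma> B by (simp add: L1_add L1_e_set)
      have C: "?\<alpha> \<in> ?C"
        by (rule FI_add_closed) (use \<gamma>(1) B(1) e_C in simp_all)
      have "\<phi> ?\<alpha> = (\<lambda>x y. \<phi> (e_set B) x y + \<psi> \<gamma> x y)"
        using C L1 \<gamma> B e_C by (simp add: \<phi> \<psi>_add L1_e_set add.assoc)
      also have "\<dots> = \<beta>"
        \<comment> \<open>\<open>\<phi> (e_set B)\<close> occurs twice and cancels.\<close>
        by (simp add: \<gamma>(2) fun_eq_iff add.left_commute)
      finally show ?thesis
        using C by blast
    qed
    then show "\<phi> ` ?C = ?C"
      using \<phi>_C by blast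
  qed

  \<comment> \<open>Injectivity, given injectivity of \<open>lam\<close>\<close>
  have inj_iff: "inj_on \<phi> ?C \<longleftrightarrow> inj_on \<psi> ?J" if inj: "inj_on lam (Pow X)"
  proof
    assume "inj_on \<phi> ?C"
    then have "inj_on \<phi> ?J"
      by (rule inj_on_subset) blast
    moreover have "inj_on \<phi> ?J \<longleftrightarrow> inj_on \<psi> ?J"
      by (rule inj_on_cong) (rule \<phi>_radical)
    ultimately show "inj_on \<psi> ?J"
      by simp
  next
    assume inj\<psi>: "inj_on \<psi> ?J"
    show "inj_on \<phi> ?C"
    proof (rule inj_onI)
      fix \<alpha> \<beta> assume C: "\<alpha> \<in> ?C" "\<beta> \<in> ?C" and eq: "\<phi> \<alpha> = \<phi> \<beta>"
      have "lam (L1 X \<alpha>) = lam (L1 X \<beta>)"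
        using C eq L1_\<phi> by metis
      then have L1: "L1 X \<alpha> = L1 X \<beta>"
        by (rule inj_onD[OF inj]) (simp_all add: L1_sub)
      \<comment> \<open>Equal diagonals give equal \<open>e_set\<close> summands, which
        cancel.\<close>
      have "\<psi> \<alpha> = \<psi> \<beta>"
        using eq C by (simp add: \<phi> L1 fun_eq_iff)
      \<comment> \<open>\<open>?\<gamma>\<close> is the difference of \<open>\<alpha>\<close> and
        \<open>\<beta>\<close>, and \<open>?z\<close> is zero written as a sum:
        \<open>\<psi>_add\<close> then applies to both, and cancelling \<open>\<beta>\<close>
        finishes.\<close>
      let ?\<gamma> = "\<lambda>x y. \<alpha> x y + \<beta> x y" and ?z = "\<lambda>x y. \<beta> x y + \<beta> x y"
      have "\<psi> ?\<gamma> = \<psi> ?z"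
        unfolding \<psi>_add[OF C] \<psi>_add[OF C(2) C(2)] \<open>\<psi> \<alpha> = \<psi> \<beta>\<close> ..
      moreover have "?\<gamma> \<in> ?J"
        using FI_add_closed[OF C] L1_add[of X \<alpha> \<beta>] L1 by simp
      moreover have "?z \<in> ?J"
        using FI_add_closed[OF C(2) C(2)] L1_add[of X \<beta> \<beta>] by simp
      ultimately have "?\<gamma> = ?z"
        by (rule inj_onD[OF inj\<psi>])
      then show "\<alpha> = \<beta>"
        unfolding fun_eq_iff add_right_cancel .
    qed
  qed
  have carriers: "carrier (FI X r) = ?C" "carrier (FI_J X r) = ?J"
    by (simp add: FI_def) (rule FI_J_carrier)
  show ?thesis
    \<comment> \<open>Each side of either equivalence contains injectivity of \<open>lam\<close>,
      the condition under which \<open>surj_iff\<close> and \<open>inj_iff\<close> hold; the rest is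
      propositional.\<close>
    unfolding carriers strong_iff iso_iff bij_betw_def using surj_iff inj_iff by argo
qed

end
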